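(* There exists $\beta_2(d)>0$ such that if $|\beta|\le\beta_2(d)$, then for every non-null loop sequence $s$, $$\sum_{X\in\mathcal{X}(s)}|w_\beta(X)|<\infty.$$
   Context: Lattice, paths and loops. $E$ is the set of directed nearest-neighbour edges of $\mathbb{Z}^d$ ($d\ge2$); $e$ goes from $u(e)$ to $v(e)$, $e^{-1}$ is the reversed edge; $e$ is positively oriented if $v(e)$ is lexicographically larger than $u(e)$. A path is a sequence $e_1\cdots e_n$ with $v(e_i)=u(e_{i+1})$, closed if $v(e_n)=u(e_1)$; the null path is closed. Cycles are classes of closed paths under cyclic rotation; each cycle has a first edge fixed by an arbitrary rule and "location $k$" is its $k$-th edge. A path has a backtrack at $i\le n-1$ if $e_{i+1}=e_i^{-1}$; a closed path also at $n$ if $e_1=e_n^{-1}$; erasing a backtrack at $i<n$ gives $e_1\cdots e_{i-1}e_{i+2}\cdots e_n$, at $n$ gives $e_2\cdots e_{n-1}$; successive erasures until none remain give a well-defined cycle $[l]$. A loop is a cycle without backtracks (including the null loop). A plaquette is a nonbacktracking closed path of length 4. Loop sequences: finite sequences of loops modulo inserting/deleting null loops; minimal representation has no null loops; $|s|=\sum|l_i|$. Operations. For non-null loops $l,l'$ and locations $x,y$: same edge $e$: $l=aeb$, $l'=ced$, $l\oplus_{x,y}l'=[aedceb]$, $l\ominus_{x,y}l'=[ac^{-1}d^{-1}b]$; $e$ vs $e^{-1}$: $l=aeb$, $l'=ce^{-1}d$, $l\oplus_{x,y}l'=[aec^{-1}d^{-1}eb]$, $l\ominus_{x,y}l'=[adcb]$.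 Positive/negative deformations of $l$: $l\oplus_{x,y}p$, $l\ominus_{x,y}p$ for plaquettes $p$ containing the edge at location $x$ of $l$ or its inverse. Distinct locations $x,y$: $l=aebec$ (displayed $e$'s at $x,y$ respectively) gives the positive splitting $([aec],[be])$; $l=aebe^{-1}c$ gives the negative splitting $([ac],[b])$. A deformation (splitting) of a loop sequence replaces one component of its minimal representation by a deformation (by the two loops of a splitting) of it. Trajectories. A trajectory is a sequence $(s_0,s_1,\dots)$ of loop sequences with each $s_{i+1}$ a deformation or splitting of $s_i$; vanishing trajectories are finite and end at the null loop sequence; $\mathcal{X}(s)$ is the set of vanishing trajectories starting at $s$. $w_\beta(s,s')=-\beta/|s|$, $\beta/|s|$, $-1/|s|$, $1/|s|$ for positive deformation, negative deformation, positive splitting, negative splitting respectively; $w_\beta(X)=\prod w_\beta(s_i,s_{i+1})$. *)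

theory Defs
  imports "HOL-Analysis.Analysis"
begin

type_synonym vertex = "int list"
type_synonym edge = "vertex \<times> vertex"
type_synonym cycle = "edge list set"
type_synonym loopseq = "cycle list"

definition lattice_edges :: "nat \<Rightarrow> edge set" where
  "lattice_edges d = {(u, v). length u = d \<and> length v = d \<and>
     (\<exists>i<d. v = u[i := u ! i + 1] \<or> v = u[i := u ! i - 1])}"

definition einv :: "edge \<Rightarrow> edge" where
  "einv e = (snd e, fst e)"

definition pinv :: "edge list \<Rightarrow> edge list" where
  "pinv p = rev (map einv p)"

definition is_path :: "nat \<Rightarrow> edge list \<Rightarrow> bool" where
  "is_path d p \<longleftrightarrow> set p \<subseteq> lattice_edges d \<and>
     (\<forall>i. Suc i < length p \<longrightarrow> snd (p ! i) = fst (p ! Suc i))"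

definition closed_path :: "nat \<Rightarrow> edge list \<Rightarrow> bool" where
  "closed_path d p \<longleftrightarrow> is_path d p \<and> (p = [] \<or> snd (last p) = fst (hd p))"

definition cyc :: "edge list \<Rightarrow> cycle" where
  "cyc p = {q. \<exists>k. q = rotate k p}"

text \<open>Erasing one backtrack (at i<n, or at n for a closed path).\<close>
definition erase1 :: "edge list \<Rightarrow> edge list \<Rightarrow> bool" where
  "erase1 p q \<longleftrightarrow>
     (\<exists>a e b. p = a @ [e, einv e] @ b \<and> q = a @ b) \<or>
     (\<exists>e m. p = e # m @ [einv e] \<and> q = m)"

definition no_backtrack :: "edge list \<Rightarrow> bool" where
  "no_backtrack p \<longleftrightarrow> \<not> (\<exists>q. erase1 p q)"

text \<open>The cycle [p] obtained by successive backtrack erasures (well defined by the paper).\<close>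
definition reduce :: "edge list \<Rightarrow> cycle" where
  "reduce p = (THE C. \<exists>q. erase1\<^sup>*\<^sup>* p q \<and> no_backtrack q \<and> C = cyc q)"

definition null_loop :: cycle where
  "null_loop = cyc []"

definition is_loop :: "nat \<Rightarrow> cycle \<Rightarrow> bool" where
  "is_loop d L \<longleftrightarrow> (\<exists>p. closed_path d p \<and> no_backtrack p \<and> L = cyc p)"

definition loop_len :: "cycle \<Rightarrow> nat" where
  "loop_len L = length (SOME p. p \<in> L)"

definition plaquettes :: "nat \<Rightarrow> cycle set" where
  "plaquettes d = {cyc q | q. closed_path d q \<and> no_backtrack q \<and> length q = 4}"

definition oplus_set :: "cycle \<Rightarrow> cycle \<Rightarrow> cycle set" where
  "oplus_set l l' =
     {reduce (a @ [e] @ dd @ c @ [e] @ b) | a e b c dd.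
        a @ [e] @ b \<in> l \<and> c @ [e] @ dd \<in> l'} \<union>
     {reduce (a @ [e] @ pinv c @ pinv dd @ [e] @ b) | a e b c dd.
        a @ [e] @ b \<in> l \<and> c @ [einv e] @ dd \<in> l'}"

definition ominus_set :: "cycle \<Rightarrow> cycle \<Rightarrow> cycle set" where
  "ominus_set l l' =
     {reduce (a @ pinv c @ pinv dd @ b) | a e b c dd.
        a @ [e] @ b \<in> l \<and> c @ [e] @ dd \<in> l'} \<union>
     {reduce (a @ dd @ c @ b) | a e b c dd.
        a @ [e] @ b \<in> l \<and> c @ [einv e] @ dd \<in> l'}"

definition pos_deformations :: "nat \<Rightarrow> cycle \<Rightarrow> cycle set" where
  "pos_deformations d l = (\<Union>p\<in>plaquettes d. oplus_set l p)"

definition neg_deformations :: "nat \<Rightarrow> cycle \<Rightarrow> cycle set" where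
  "neg_deformations d l = (\<Union>p\<in>plaquettes d. ominus_set l p)"

definition pos_splittings :: "cycle \<Rightarrow> (cycle \<times> cycle) set" where
  "pos_splittings l = {(reduce (a @ [e] @ c), reduce (b @ [e])) | a e b c.
     a @ [e] @ b @ [e] @ c \<in> l}"

definition neg_splittings :: "cycle \<Rightarrow> (cycle \<times> cycle) set" where
  "neg_splittings l = {(reduce (a @ c), reduce b) | a e b c.
     a @ [e] @ b @ [einv e] @ c \<in> l}"

section \<open>Loop sequences (minimal representations: lists of non-null loops)\<close>

definition is_loopseq :: "nat \<Rightarrow> loopseq \<Rightarrow> bool" where
  "is_loopseq d s \<longleftrightarrow> (\<forall>L\<in>set s. is_loop d L \<and> L \<noteq> null_loop)"

definition seq_len :: "loopseq \<Rightarrow> nat" where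
  "seq_len s = sum_list (map loop_len s)"

text \<open>Replace component i by the given loops, dropping null loops (minimal representation).\<close>
definition replace_comp :: "loopseq \<Rightarrow> nat \<Rightarrow> cycle list \<Rightarrow> loopseq" where
  "replace_comp s i new = take i s @ filter (\<lambda>L. L \<noteq> null_loop) new @ drop (Suc i) s"

definition is_pos_def :: "nat \<Rightarrow> loopseq \<Rightarrow> loopseq \<Rightarrow> bool" where
  "is_pos_def d s s' \<longleftrightarrow> (\<exists>i<length s. \<exists>L\<in>pos_deformations d (s ! i). s' = replace_comp s i [L])"

definition is_neg_def :: "nat \<Rightarrow> loopseq \<Rightarrow> loopseq \<Rightarrow> bool" where
  "is_neg_def d s s' \<longleftrightarrow> (\<exists>i<length s. \<exists>L\<in>neg_deformations d (s ! i). s' = replace_comp s i [L])"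

definition is_pos_split :: "loopseq \<Rightarrow> loopseq \<Rightarrow> bool" where
  "is_pos_split s s' \<longleftrightarrow> (\<exists>i<length s. \<exists>(L1, L2)\<in>pos_splittings (s ! i). s' = replace_comp s i [L1, L2])"

definition is_neg_split :: "loopseq \<Rightarrow> loopseq \<Rightarrow> bool" where
  "is_neg_split s s' \<longleftrightarrow> (\<exists>i<length s. \<exists>(L1, L2)\<in>neg_splittings (s ! i). s' = replace_comp s i [L1, L2])"

definition is_move :: "nat \<Rightarrow> loopseq \<Rightarrow> loopseq \<Rightarrow> bool" where
  "is_move d s s' \<longleftrightarrow> is_pos_def d s s' \<or> is_neg_def d s s' \<or> is_pos_split s s' \<or> is_neg_split s s'"

definition step_weight :: "nat \<Rightarrow> real \<Rightarrow> loopseq \<Rightarrow> loopseq \<Rightarrow> real" where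
  "step_weight d \<beta> s s' =
     (if is_pos_def d s s' then - \<beta> / real (seq_len s)
      else if is_neg_def d s s' then \<beta> / real (seq_len s)
      else if is_pos_split s s' then - 1 / real (seq_len s)
      else if is_neg_split s s' then 1 / real (seq_len s)
      else 0)"

definition vanishing_trajectories :: "nat \<Rightarrow> loopseq \<Rightarrow> loopseq list set" where
  "vanishing_trajectories d s = {X. X \<noteq> [] \<and> hd X = s \<and> last X = [] \<and>
     (\<forall>i. Suc i < length X \<longrightarrow> is_move d (X ! i) (X ! Suc i))}"

definition traj_weight :: "nat \<Rightarrow> real \<Rightarrow> loopseq list \<Rightarrow> real" where
  "traj_weight d \<beta> X = (\<Prod>i<length X - 1. step_weight d \<beta> (X ! i) (X ! Suc i))"

end

(* Give a loop of length m the weight h m = 32^m / (32 m^2), and the null loop the weight 1, and a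
   loop sequence the product of the weights of its components.  The inverse-square factor makes the
   convolution of h with itself at most h m / 4, so all splittings of a loop contribute at most
   m * h m / 2; a deformation adds at most 4 edges and there are at most 32 d^3 m of them, so for
   small beta they also contribute at most m * h m / 2.  Since the steps from s carry the factor
   1/|s|, the sum of |w(s, s')| times the weight of s' is at most the weight of s, and by induction
   on the length every finite partial sum over trajectories is at most the weight of s. *)
theory Submission
  imports Defs "HOL-Library.Confluence"
begin

section \<open>Cycles and uniqueness of the reduced cycle\<close>

lemma einv_einv [simp]: "einv (einv e) = e"
  by (simp add: einv_def)

text \<open>Cutting a word in two, instead of rotating by an index, turns later comparisons of
  positions on a cycle into case analyses on lists.\<close>

lemma in_cyc_iff: "q \<in> cyc p \<longleftrightarrow> (\<exists>a b. p = a @ b \<and> q = b @ a)"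
proof
  assume "q \<in> cyc p"
  then show "\<exists>a b. p = a @ b \<and> q = b @ a"
    by (auto simp: cyc_def rotate_drop_take) (metis append_take_drop_id)
next
  assume "\<exists>a b. p = a @ b \<and> q = b @ a"
  then show "q \<in> cyc p"
    unfolding cyc_def by (metis (mono_tags) mem_Collect_eq rotate_append)
qed

lemma cyc_refl [simp]: "p \<in> cyc p"
  using in_cyc_iff by fastforce

lemma in_cyc_trans: "q \<in> cyc p \<Longrightarrow> r \<in> cyc q \<Longrightarrow> r \<in> cyc p"
  unfolding cyc_def by (auto simp: rotate_rotate)

lemma in_cyc_sym: "q \<in> cyc p \<Longrightarrow> p \<in> cyc q"
  unfolding in_cyc_iff by blast

lemma cyc_eq: "q \<in> cyc p \<Longrightarrow> cyc q = cyc p"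
  using in_cyc_trans in_cyc_sym by blast

lemma cyc_append_swap: "cyc (a @ b) = cyc (b @ a)"
  by (rule cyc_eq) (auto simp: in_cyc_iff)

lemma cyc_length: "q \<in> cyc p \<Longrightarrow> length q = length p"
  by (auto simp: cyc_def)

lemma loop_len_cyc [simp]: "loop_len (cyc p) = length p"
  unfolding loop_len_def by (rule someI2[of _ p]) (auto dest: cyc_length)

lemma cyc_Nil_iff [simp]: "cyc p = cyc [] \<longleftrightarrow> p = []"
  by (auto dest: arg_cong[where f = loop_len])

lemma cyc_subset: "cyc p \<subseteq> (\<lambda>k. rotate k p) ` (if p = [] then {0} else {..<length p})"
proof
  fix q assume "q \<in> cyc p"
  then obtain k where q: "q = rotate k p" by (auto simp: cyc_def)
  show "q \<in> (\<lambda>k. rotate k p) ` (if p = [] then {0} else {..<length p})"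
  proof (cases "p = []")
    case False
    then show ?thesis
      using q rotate_conv_mod[of k p] by (auto intro!: image_eqI[of _ _ "k mod length p"])
  qed (use q in auto)
qed

lemma finite_cyc [simp]: "finite (cyc p)"
  using cyc_subset by (rule finite_subset) auto

lemma card_cyc_le: "p \<noteq> [] \<Longrightarrow> card (cyc p) \<le> length p"
  using surj_card_le[OF _ cyc_subset[of p]] by simp

text \<open>On cycles, erasing at an inner position and at the seam become the same operation, so that
  two erasures either commute or overlap in one edge and then agree.\<close>

definition cyc_erase :: "cycle \<Rightarrow> cycle \<Rightarrow> bool" where
  "cyc_erase C D \<longleftrightarrow> (\<exists>e m. C = cyc (e # einv e # m) \<and> D = cyc m)"

lemma erase1_imp_cyc_erase:
  assumes "erase1 p q"
  shows "cyc_erase (cyc p) (cyc q)"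
  using assms unfolding erase1_def
proof (elim disjE exE conjE)
  fix a e b assume "p = a @ [e, einv e] @ b" "q = a @ b"
  then have "cyc p = cyc (e # einv e # (b @ a))" "cyc q = cyc (b @ a)"
    using cyc_append_swap[of a "[e, einv e] @ b"] cyc_append_swap[of a b] by auto
  then show ?thesis unfolding cyc_erase_def by blast
next
  fix e m assume "p = e # m @ [einv e]" "q = m"
  \<comment> \<open>Moving the last edge to the front turns the seam backtrack into an initial
    pair.\<close>
  then have "cyc p = cyc (einv e # einv (einv e) # m)"
    using cyc_append_swap[of "e # m" "[einv e]"] by auto
  with \<open>q = m\<close> show ?thesis unfolding cyc_erase_def by blast
qed

text \<open>A rotation can separate an adjacent pair only by cutting between its two edges; they
  then face each other across the seam, where \<open>erase1\<close> applies as well.\<close>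

lemma no_backtrack_imp_not_cyc_erase:
  assumes "no_backtrack q"
  shows "\<not> cyc_erase (cyc q) D"
proof
  assume "cyc_erase (cyc q) D"
  then obtain e m where "cyc q = cyc (e # einv e # m)" by (auto simp: cyc_erase_def)
  then have "q \<in> cyc (e # einv e # m)" using cyc_refl[of q] by simp
  then obtain a b where ab: "e # einv e # m = a @ b" and q: "q = b @ a"
    by (auto simp: in_cyc_iff)
  have "\<exists>r. erase1 q r"
  proof (cases a)
    case Nil
    then have "q = [] @ [e, einv e] @ m" using ab q by simp
    then show ?thesis unfolding erase1_def by blast
  next
    case (Cons x a')
    note a = this
    show ?thesis
    proof (cases a')
      case Nil
      then have "q = einv e # m @ [einv (einv e)]" using a ab q by auto
      then show ?thesis unfolding erase1_def by blast
    next
      case (Cons y a'')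
      then have "q = b @ [e, einv e] @ a''" using a ab q by auto
      then show ?thesis unfolding erase1_def by blast
    qed
  qed
  with assms show False by (simp add: no_backtrack_def)
qed

text \<open>Rotating one representation into the other leaves three situations: the same pair;
  overlapping pairs, whose erasures give the same cycle; and disjoint pairs, each of which survives
  the erasure of the other.\<close>

lemma cyc_erase_diamond:
  assumes "cyc_erase C D" "cyc_erase C D'"
  shows "D = D' \<or> (\<exists>E. cyc_erase D E \<and> cyc_erase D' E)"
proof -
  obtain e m where C: "C = cyc (e # einv e # m)" and D: "D = cyc m"
    using assms(1) by (auto simp: cyc_erase_def)
  obtain f n where C': "C = cyc (f # einv f # n)" and D': "D' = cyc n"
    using assms(2) by (auto simp: cyc_erase_def)
  have "f # einv f # n \<in> cyc (e # einv e # m)" using C C' cyc_refl[of "f # einv f # n"] by simp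
  then obtain a b where ab: "e # einv e # m = a @ b" "f # einv f # n = b @ a"
    by (auto simp: in_cyc_iff)
  \<comment> \<open>\<open>remdups_adj.cases\<close> is borrowed for its three cases: no, one, or at
    least two elements. Here \<open>a\<close> is what precedes the second pair when reading from the
    first.\<close>
  consider "a = []" | x where "a = [x]" | x y a' where "a = x # y # a'"
    by (cases a rule: remdups_adj.cases) auto
  then show ?thesis
  proof cases
    case 1
    then show ?thesis using ab D D' by auto
  next
    case 2
    then have b: "b = einv e # m" and n: "f = einv e" "einv f # n = m @ [e]"
      using ab by auto
    show ?thesis
    proof (cases m)
      case Nil
      then show ?thesis using n D D' by simp
    next
      case (Cons x m')
      then have "m = [e] @ m'" "n = m' @ [e]" using n by auto
      then show ?thesis using D D' cyc_append_swap[of "[e]" m'] by simp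
    qed
  next
    case 3
    then have m: "m = a' @ b" and n: "f # einv f # n = b @ [e, einv e] @ a'"
      using ab by auto
    consider "b = []" | "b = [f]" | b' where "b = f # einv f # b'"
      using n by (cases b rule: remdups_adj.cases) auto
    then show ?thesis
    proof cases
      case 1
      then show ?thesis using m n D D' by simp
    next
      case 2
      then have "n = [f] @ a'" "m = a' @ [f]" using m n by auto
      then show ?thesis using D D' cyc_append_swap[of "[f]" a'] by simp
    next
      case 3
      then have n': "n = b' @ [e, einv e] @ a'" using n by auto
      have "cyc m = cyc (f # einv f # (b' @ a'))"
        using cyc_append_swap[of a' b] m 3 by simp
      moreover have "cyc n = cyc (e # einv e # (a' @ b'))"
        using cyc_append_swap[of b' "[e, einv e] @ a'"] n' by simp
      ultimately have "cyc_erase D (cyc (b' @ a'))" "cyc_erase D' (cyc (b' @ a'))"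
        using D D' cyc_append_swap[of a' b'] unfolding cyc_erase_def by blast+
      then show ?thesis by blast
    qed
  qed
qed

lemma confluentp_cyc_erase: "confluentp cyc_erase"
proof (rule strong_confluentp_imp_confluentp, rule strong_confluentpI)
  fix C D D' assume "cyc_erase C D" "cyc_erase C D'"
  from cyc_erase_diamond[OF this]
  show "\<exists>u. cyc_erase\<^sup>*\<^sup>* D u \<and> cyc_erase\<^sup>=\<^sup>= D' u" by blast
qed

section \<open>Normal forms under erasure\<close>

lemma erase1_rtranclp_imp_cyc_erase:
  assumes "erase1\<^sup>*\<^sup>* p q"
  shows "cyc_erase\<^sup>*\<^sup>* (cyc p) (cyc q)"
  using assms
  by induction (auto intro: rtranclp.rtrancl_into_rtrancl dest: erase1_imp_cyc_erase)

text \<open>Confluence yields a common descendant of both end cycles, and a cycle without backtracks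
  has no descendant but itself. Allowing two representatives of one cycle makes
  \<open>reduce\<close> invariant under rotation.\<close>

lemma cyc_normal_form_unique:
  assumes "cyc p = cyc p'"
    and "erase1\<^sup>*\<^sup>* p q" "no_backtrack q" "erase1\<^sup>*\<^sup>* p' q'" "no_backtrack q'"
  shows "cyc q = cyc q'"
proof -
  have "cyc_erase\<^sup>*\<^sup>* (cyc p) (cyc q)" "cyc_erase\<^sup>*\<^sup>* (cyc p) (cyc q')"
    using assms(1) erase1_rtranclp_imp_cyc_erase[OF assms(2)]
      erase1_rtranclp_imp_cyc_erase[OF assms(4)] by simp_all
  then obtain U where "cyc_erase\<^sup>*\<^sup>* (cyc q) U" "cyc_erase\<^sup>*\<^sup>* (cyc q') U"
    using confluentpD[OF confluentp_cyc_erase] by blast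
  moreover have "U = cyc r" if "cyc_erase\<^sup>*\<^sup>* (cyc r) U" "no_backtrack r" for r
    using that(1) by (cases rule: converse_rtranclpE)
      (use no_backtrack_imp_not_cyc_erase[OF that(2)] in auto)
  ultimately show ?thesis using assms(3,5) by blast
qed

lemma erase1_length: "erase1 p q \<Longrightarrow> length q < length p"
  by (auto simp: erase1_def)

lemma normal_form_exists:
  "\<exists>q. erase1\<^sup>*\<^sup>* p q \<and> no_backtrack q \<and> length q \<le> length p"
proof (induction p rule: measure_induct_rule[of length])
  case (less p)
  show ?case
  proof (cases "no_backtrack p")
    case False
    then obtain r where "erase1 p r" by (auto simp: no_backtrack_def)
    with less[of r] erase1_length[of p r] show ?thesis
      by (meson converse_rtranclp_into_rtranclp less_imp_le order_trans)
  qed auto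
qed

lemma reduce_eqI:
  assumes "erase1\<^sup>*\<^sup>* p q" "no_backtrack q"
  shows "reduce p = cyc q"
  unfolding reduce_def
  by (rule the_equality) (use assms cyc_normal_form_unique in blast)+

text \<open>Existence and uniqueness make the definite description in \<open>reduce\<close>
  meaningful for every list of edges, closed path or not.\<close>

lemma reduceE:
  obtains q where "reduce p = cyc q" "length q \<le> length p" "no_backtrack q" "erase1\<^sup>*\<^sup>* p q"
  using normal_form_exists[of p] reduce_eqI by blast

lemma reduce_range_cyc: "reduce p \<in> range cyc"
  by (rule reduceE[of p]) simp

lemma reduce_cong_cyc:
  assumes "cyc p = cyc p'"
  shows "reduce p = reduce p'"
proof -
  obtain q where "reduce p = cyc q" "no_backtrack q" "erase1\<^sup>*\<^sup>* p q" by (rule reduceE)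
  moreover obtain q' where "reduce p' = cyc q'" "no_backtrack q'" "erase1\<^sup>*\<^sup>* p' q'" by (rule reduceE)
  ultimately show ?thesis using cyc_normal_form_unique[OF assms] by simp
qed

lemma reduce_append_swap: "reduce (a @ b) = reduce (b @ a)"
  by (rule reduce_cong_cyc) (rule cyc_append_swap)

lemma loop_len_reduce: "loop_len (reduce p) \<le> length p"
  by (rule reduceE[of p]) simp

section \<open>Counting deformations and splittings\<close>

lemma is_path_iff_successively:
  "is_path d p \<longleftrightarrow> set p \<subseteq> lattice_edges d \<and> successively (\<lambda>e f. snd e = fst f) p"
  by (auto simp: is_path_def successively_conv_nth)

lemma closed_path_append_swap: "closed_path d (a @ b) \<Longrightarrow> is_path d (b @ a)"
  by (cases "a = []"; cases "b = []")
     (auto simp: closed_path_def is_path_iff_successively successively_append_iff)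

text \<open>A plaquette read from its edge \<open>e\<close>, with \<open>e\<close> removed, is such
  a tail with \<open>n = 3\<close>. That the path closes up is forgotten, which can only enlarge the
  count.\<close>

definition path_tails :: "nat \<Rightarrow> edge \<Rightarrow> nat \<Rightarrow> edge list set" where
  "path_tails d e n = {r. length r = n \<and> is_path d (e # r)}"

lemma out_edges:
  "finite {f \<in> lattice_edges d. fst f = v}" "card {f \<in> lattice_edges d. fst f = v} \<le> 2 * d"
proof -
  have "{f \<in> lattice_edges d. fst f = v} \<subseteq> (\<lambda>(i, c). (v, v[i := v ! i + c])) ` ({..<d} \<times> {1, -1})"
    by (fastforce simp: lattice_edges_def image_iff)
  note sub = this
  show "finite {f \<in> lattice_edges d. fst f = v}"
    using sub by (rule finite_subset) auto
  show "card {f \<in> lattice_edges d. fst f = v} \<le> 2 * d"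
    using surj_card_le[OF _ sub] by (simp add: mult.commute)
qed

lemma path_tails_bound: "finite (path_tails d e n) \<and> card (path_tails d e n) \<le> (2 * d) ^ n"
proof (induction n arbitrary: e)
  case 0
  have "path_tails d e 0 \<subseteq> {[]}" by (auto simp: path_tails_def)
  then show ?case using card_mono[of "{[]}" "path_tails d e 0"] by (auto dest: finite_subset)
next
  case (Suc n)
  let ?out = "{f \<in> lattice_edges d. fst f = snd e}"
  have sub: "path_tails d e (Suc n) \<subseteq> (\<Union>f\<in>?out. (#) f ` path_tails d f n)"
  proof
    fix r assume r: "r \<in> path_tails d e (Suc n)"
    then obtain f r' where fr: "r = f # r'" "length r' = n"
      by (auto simp: path_tails_def length_Suc_conv)
    then have "f \<in> ?out" "r' \<in> path_tails d f n"
      using r by (auto simp: path_tails_def is_path_iff_successively)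
    with fr(1) show "r \<in> (\<Union>f\<in>?out. (#) f ` path_tails d f n)" by blast
  qed
  have fin: "finite (\<Union>f\<in>?out. (#) f ` path_tails d f n)"
    using Suc out_edges(1) by blast
  have "card (path_tails d e (Suc n)) \<le> (\<Sum>f\<in>?out. card ((#) f ` path_tails d f n))"
    by (rule order_trans[OF card_mono[OF fin sub] card_UN_le[OF out_edges(1)]])
  also have "\<dots> \<le> (\<Sum>f\<in>?out. (2 * d) ^ n)"
    using Suc by (intro sum_mono order_trans[OF card_image_le]) auto
  also have "\<dots> \<le> (2 * d) ^ Suc n"
    using out_edges(2) by simp
  finally show ?case using fin sub finite_subset by blast
qed

text \<open>Read from \<open>e\<close> on, the plaquette passes through \<open>r\<close> and then,
  across the seam, through \<open>c\<close>.\<close>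

lemma plaquette_tail:
  assumes "P \<in> plaquettes d" "c @ [e] @ r \<in> P"
  shows "r @ c \<in> path_tails d e 3"
proof -
  obtain q where q: "P = cyc q" "closed_path d q" "length q = 4"
    using assms(1) by (auto simp: plaquettes_def)
  obtain a b where ab: "q = a @ b" "c @ [e] @ r = b @ a"
    using assms(2) q(1) by (auto simp: in_cyc_iff)
  have "closed_path d (c @ [e] @ r)"
  proof -
    have "is_path d (b @ a)" using q(2) ab(1) closed_path_append_swap by blast
    moreover have "b @ a = [] \<or> snd (last (b @ a)) = fst (hd (b @ a))"
      using q(2) ab(1) unfolding closed_path_def is_path_iff_successively
      by (cases "a = []"; cases "b = []") (auto simp: successively_append_iff)
    ultimately show ?thesis using ab(2) by (simp add: closed_path_def)
  qed
  then have "is_path d (([e] @ r) @ c)" by (rule closed_path_append_swap)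
  moreover have "length (c @ [e] @ r) = 4" using ab q by simp
  ultimately show ?thesis by (simp add: path_tails_def)
qed

lemma cyc_rotate_mem: "a @ b \<in> cyc p \<Longrightarrow> b @ a \<in> cyc p"
  using in_cyc_trans in_cyc_iff by blast

section \<open>Deformations of a single loop\<close>

definition deformations :: "nat \<Rightarrow> cycle \<Rightarrow> cycle set" where
  "deformations d L = pos_deformations d L \<union> neg_deformations d L"

text \<open>Rotating both the loop and the plaquette so that they start at the chosen edge, a
  deformation is determined by a rotation \<open>q\<close> of the loop and the remaining three edges \<open>r\<close>
  of the plaquette.\<close>

lemma deformations_subset:
  assumes "L = cyc p"
  shows "deformations d L \<subseteq>
    (\<lambda>(q, r). reduce (hd q # r @ q)) ` (SIGMA q:L. path_tails d (hd q) 3) \<union>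
    (\<lambda>(q, r). reduce (hd q # pinv r @ q)) ` (SIGMA q:L. path_tails d (einv (hd q)) 3) \<union>
    (\<lambda>(q, r). reduce (pinv r @ tl q)) ` (SIGMA q:L. path_tails d (hd q) 3) \<union>
    (\<lambda>(q, r). reduce (r @ tl q)) ` (SIGMA q:L. path_tails d (einv (hd q)) 3)"
    (is "_ \<subseteq> ?A \<union> ?B \<union> ?C \<union> ?D")
proof
  fix M assume "M \<in> deformations d L"
  then obtain P where P: "P \<in> plaquettes d" and M: "M \<in> oplus_set L P \<union> ominus_set L P"
    by (auto simp: deformations_def pos_deformations_def neg_deformations_def)
  have pinv_append: "pinv c @ pinv r = pinv (r @ c)" for c r by (simp add: pinv_def)
  have mem: "e # b @ a \<in> L" if "a @ [e] @ b \<in> L" for a e b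
    using that cyc_rotate_mem[of a "[e] @ b" p] assms by simp
  from M consider
    a e b c r where "M = reduce (a @ [e] @ r @ c @ [e] @ b)" "a @ [e] @ b \<in> L" "c @ [e] @ r \<in> P"
  | a e b c r where "M = reduce (a @ [e] @ pinv c @ pinv r @ [e] @ b)" "a @ [e] @ b \<in> L" "c @ [einv e] @ r \<in> P"
  | a e b c r where "M = reduce (a @ pinv c @ pinv r @ b)" "a @ [e] @ b \<in> L" "c @ [e] @ r \<in> P"
  | a e b c r where "M = reduce (a @ r @ c @ b)" "a @ [e] @ b \<in> L" "c @ [einv e] @ r \<in> P"
    unfolding oplus_set_def ominus_set_def by blast
  then show "M \<in> ?A \<union> ?B \<union> ?C \<union> ?D"
  proof cases
    case (1 a e b c r)
    \<comment> \<open>The rotation \<open>e # b @ a\<close> already starts with \<open>e\<close>, so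
      one extra \<open>hd q\<close> produces the doubled edge of a positive deformation; for a
      negative one \<open>tl\<close> removes the edge.\<close>
    then have "M = reduce (e # (r @ c) @ e # b @ a)"
      using reduce_append_swap[of a "[e] @ r @ c @ [e] @ b"] by simp
    with mem[OF 1(2)] plaquette_tail[OF P 1(3)] have "M \<in> ?A"
      by (intro image_eqI[of _ _ "(e # b @ a, r @ c)"]) auto
    then show ?thesis by blast
  next
    case (2 a e b c r)
    then have "M = reduce (e # pinv (r @ c) @ e # b @ a)"
      using reduce_append_swap[of a "[e] @ pinv c @ pinv r @ [e] @ b"] by (simp add: pinv_append[symmetric])
    with mem[OF 2(2)] plaquette_tail[OF P 2(3)] have "M \<in> ?B"
      by (intro image_eqI[of _ _ "(e # b @ a, r @ c)"]) auto
    then show ?thesis by blast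
  next
    case (3 a e b c r)
    then have "M = reduce (pinv (r @ c) @ b @ a)"
      using reduce_append_swap[of a "pinv c @ pinv r @ b"] by (simp add: pinv_append[symmetric])
    with mem[OF 3(2)] plaquette_tail[OF P 3(3)] have "M \<in> ?C"
      by (intro image_eqI[of _ _ "(e # b @ a, r @ c)"]) auto
    then show ?thesis by blast
  next
    case (4 a e b c r)
    then have "M = reduce ((r @ c) @ b @ a)"
      using reduce_append_swap[of a "r @ c @ b"] by simp
    with mem[OF 4(2)] plaquette_tail[OF P 4(3)] have "M \<in> ?D"
      by (intro image_eqI[of _ _ "(e # b @ a, r @ c)"]) auto
    then show ?thesis by blast
  qed
qed

text \<open>There are four ways of joining, at most \<open>length p\<close> rotations, and at most
  \<open>2 * d\<close> choices for each of the three remaining plaquette edges.\<close>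

lemma finite_card_deformations:
  assumes "p \<noteq> []"
  shows "finite (deformations d (cyc p)) \<and> card (deformations d (cyc p)) \<le> 4 * (length p * (2 * d) ^ 3)"
proof -
  define S where "S = (\<lambda>g. SIGMA q:cyc p. path_tails d (g (hd q)) 3)"
  have S: "finite (S g)" "card (S g) \<le> length p * (2 * d) ^ 3" for g
  proof -
    show "finite (S g)" using path_tails_bound by (simp add: S_def)
    have "card (S g) = (\<Sum>q\<in>cyc p. card (path_tails d (g (hd q)) 3))"
      using path_tails_bound by (simp add: S_def)
    also have "\<dots> \<le> (\<Sum>q\<in>cyc p. (2 * d) ^ 3)"
      using path_tails_bound by (intro sum_mono) blast
    also have "\<dots> \<le> length p * (2 * d) ^ 3"
      using card_cyc_le[OF assms] by simp
    finally show "card (S g) \<le> length p * (2 * d) ^ 3" .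
  qed
  have im: "card (f ` S g) \<le> length p * (2 * d) ^ 3" for f :: "_ \<Rightarrow> cycle" and g
    using card_image_le[OF S(1)] S(2) order_trans by blast
  \<comment> \<open>Only the shape of the four images matters for the count, so their maps are
    abstracted; the \<open>g\<close>'s come from the identity and \<open>einv\<close>.\<close>
  obtain f1 f2 f3 f4 :: "edge list \<times> edge list \<Rightarrow> cycle" and g1 g2 g3 g4
    where sub: "deformations d (cyc p) \<subseteq> f1 ` S g1 \<union> f2 ` S g2 \<union> f3 ` S g3 \<union> f4 ` S g4" (is "_ \<subseteq> ?U")
    using deformations_subset[OF refl, of d p] unfolding S_def by meson
  have fin: "finite ?U" using S(1) by blast
  have "card (deformations d (cyc p)) \<le> card ?U" using card_mono[OF fin sub] .
  also have "\<dots> \<le> card (f1 ` S g1) + card (f2 ` S g2) + card (f3 ` S g3) + card (f4 ` S g4)"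
    by (meson card_Un_le add_mono order_refl order_trans)
  also have "\<dots> \<le> 4 * (length p * (2 * d) ^ 3)"
    using im[of f1 g1] im[of f2 g2] im[of f3 g3] im[of f4 g4] by linarith
  finally show ?thesis using finite_subset[OF sub fin] by blast
qed

lemma deformations_range_cyc: "M \<in> deformations d (cyc p) \<Longrightarrow> M \<in> range cyc"
  using deformations_subset[OF refl, of d p] reduce_range_cyc
  by (auto simp del: image_eqI dest!: subsetD)

text \<open>The longest unreduced word repeats the chosen edge and adds three plaquette edges;
  reduction never lengthens it.\<close>

lemma loop_len_deformation:
  assumes "M \<in> deformations d (cyc p)"
  shows "loop_len M \<le> length p + 4"
  using subsetD[OF deformations_subset[OF refl] assms]
proof (elim UnE)
qed (auto dest!: cyc_length simp: path_tails_def pinv_def intro!: loop_len_reduce[THEN order_trans])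

section \<open>Splittings of a single loop\<close>

definition splittings :: "cycle \<Rightarrow> (cycle \<times> cycle) set" where
  "splittings L = pos_splittings L \<union> neg_splittings L"

text \<open>Once the loop is rotated to start at the first chosen edge, the other one sits at
  position \<open>k = Suc (length b)\<close>, and rotation and \<open>k\<close> determine the
  result. A positive splitting has the unreduced lengths \<open>length p - k\<close> and
  \<open>k\<close>.\<close>

lemma splittings_subset:
  assumes "L = cyc p"
  shows "pos_splittings L \<subseteq>
      (\<lambda>(q, k). (reduce (hd q # drop (Suc k) q), reduce (take k (tl q)))) ` (L \<times> {1..<length p})"
    and "neg_splittings L \<subseteq>
      (\<lambda>(q, k). (reduce (drop (Suc k) q), reduce (take (k - 1) (tl q)))) ` (L \<times> {1..<length p})"
proof -
  have mem: "e # b @ f # c @ a \<in> L" if "a @ [e] @ b @ [f] @ c \<in> L" for a e b f c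
    using that cyc_rotate_mem[of a "[e] @ b @ [f] @ c" p] assms by simp
  have len: "length q = length p" if "q \<in> L" for q
    using that assms cyc_length by simp
  show "pos_splittings L \<subseteq>
      (\<lambda>(q, k). (reduce (hd q # drop (Suc k) q), reduce (take k (tl q)))) ` (L \<times> {1..<length p})"
  proof
    fix x assume "x \<in> pos_splittings L"
    then obtain a e b c where x: "x = (reduce (a @ [e] @ c), reduce (b @ [e]))"
      and L: "a @ [e] @ b @ [e] @ c \<in> L"
      by (auto simp: pos_splittings_def)
    have "reduce (a @ [e] @ c) = reduce (e # c @ a)"
      using reduce_append_swap[of a "[e] @ c"] by simp
    then show "x \<in> (\<lambda>(q, k). (reduce (hd q # drop (Suc k) q), reduce (take k (tl q)))) ` (L \<times> {1..<length p})"
      using x mem[OF L] len[OF L]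
      by (intro image_eqI[of _ _ "(e # b @ e # c @ a, Suc (length b))"]) auto
  qed
  show "neg_splittings L \<subseteq>
      (\<lambda>(q, k). (reduce (drop (Suc k) q), reduce (take (k - 1) (tl q)))) ` (L \<times> {1..<length p})"
  proof
    fix x assume "x \<in> neg_splittings L"
    then obtain a e b c where x: "x = (reduce (a @ c), reduce b)"
      and L: "a @ [e] @ b @ [einv e] @ c \<in> L"
      by (auto simp: neg_splittings_def)
    then show "x \<in> (\<lambda>(q, k). (reduce (drop (Suc k) q), reduce (take (k - 1) (tl q)))) ` (L \<times> {1..<length p})"
      using mem[OF L] len[OF L] reduce_append_swap[of a c]
      by (intro image_eqI[of _ _ "(e # b @ einv e # c @ a, Suc (length b))"]) auto
  qed
qed

lemma splittings_range_cyc: "(M, N) \<in> splittings L \<Longrightarrow> M \<in> range cyc \<and> N \<in> range cyc"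
  unfolding splittings_def pos_splittings_def neg_splittings_def using reduce_range_cyc by blast

lemma finite_splittings: "finite (splittings (cyc p))"
  unfolding splittings_def
  by (intro finite_UnI splittings_subset[OF refl, THEN finite_subset]) simp_all

text \<open>A negative splitting has the lengths \<open>length p - k - 1\<close> and \<open>k - 1\<close>; by monotonicity of \<open>h\<close> it is
  counted like a positive one.\<close>

lemma sum_splittings_le:
  fixes h :: "nat \<Rightarrow> real"
  assumes "p \<noteq> []" "mono h" "\<And>k. 0 \<le> h k"
  shows "(\<Sum>(M, N)\<in>splittings (cyc p). h (loop_len M) * h (loop_len N))
           \<le> 2 * (length p * (\<Sum>k=1..<length p. h (length p - k) * h k))"
proof -
  let ?m = "length p" and ?H = "\<lambda>(M, N). h (loop_len M) * h (loop_len N)"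
  \<comment> \<open>Both kinds are enumerated by a rotation and a position, so one estimate for a
    general enumeration \<open>F\<close> serves twice.\<close>
  have gen: "sum ?H S \<le> ?m * (\<Sum>k=1..<?m. h (?m - k) * h k)"
    if S: "S \<subseteq> F ` (cyc p \<times> {1..<?m})"
      and F: "\<And>q k. \<lbrakk>length q = ?m; 1 \<le> k; k < ?m\<rbrakk> \<Longrightarrow>
          loop_len (fst (F (q, k))) \<le> ?m - k \<and> loop_len (snd (F (q, k))) \<le> k" for S F
  proof -
    let ?T = "cyc p \<times> {1..<?m}"
    have nonneg: "0 \<le> ?H x" for x using assms(3) by (auto split: prod.split)
    have "sum ?H S \<le> sum ?H (F ` ?T)"
      using S nonneg by (intro sum_mono2) auto
    also have "\<dots> \<le> (\<Sum>x\<in>?T. ?H (F x))"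
      using nonneg sum_image_le[of ?T ?H F] by (auto simp: o_def)
    also have "\<dots> \<le> (\<Sum>(q, k)\<in>?T. h (?m - k) * h k)"
    proof (rule sum_mono)
      fix x assume "x \<in> ?T"
      then obtain q k where x: "x = (q, k)" "length q = ?m" "1 \<le> k" "k < ?m"
        using cyc_length by auto
      with F[of q k] assms(2,3) show "?H (F x) \<le> (case x of (q, k) \<Rightarrow> h (?m - k) * h k)"
        by (auto simp: case_prod_unfold intro!: mult_mono monoD[OF assms(2)])
    qed
    also have "\<dots> = card (cyc p) * (\<Sum>k=1..<?m. h (?m - k) * h k)"
      by (simp add: sum.cartesian_product[symmetric])
    also have "\<dots> \<le> ?m * (\<Sum>k=1..<?m. h (?m - k) * h k)"
      using card_cyc_le[OF assms(1)] assms(3) by (intro mult_right_mono sum_nonneg) auto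
    finally show ?thesis .
  qed
  have "sum ?H (splittings (cyc p)) \<le> sum ?H (pos_splittings (cyc p)) + sum ?H (neg_splittings (cyc p))"
  proof -
    have "finite (pos_splittings (cyc p))" "finite (neg_splittings (cyc p))"
      using finite_splittings[of p] by (auto simp: splittings_def)
    moreover have "0 \<le> sum ?H (pos_splittings (cyc p) \<inter> neg_splittings (cyc p))"
      using assms(3) by (intro sum_nonneg) auto
    ultimately show ?thesis unfolding splittings_def by (simp add: sum_Un)
  qed
  also have "sum ?H (pos_splittings (cyc p)) \<le> ?m * (\<Sum>k=1..<?m. h (?m - k) * h k)"
    by (rule gen[OF splittings_subset(1)[OF refl]])
       (auto intro!: loop_len_reduce[THEN order_trans])
  also have "sum ?H (neg_splittings (cyc p)) \<le> ?m * (\<Sum>k=1..<?m. h (?m - k) * h k)"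
    by (rule gen[OF splittings_subset(2)[OF refl]])
       (auto intro!: loop_len_reduce[THEN order_trans])
  finally show ?thesis by simp
qed

section \<open>A superharmonic weight on loop sequences\<close>

text \<open>The value at \<open>0\<close> is that of the null loop, which is dropped from loop sequences; the constant
  \<open>32\<close> is just large enough for \<open>len_wt\<close> to be monotone across \<open>0\<close> and for its convolution with
  itself to lose a factor \<open>4\<close>.\<close>

definition len_wt :: "nat \<Rightarrow> real" where
  "len_wt k = (if k = 0 then 1 else 32 ^ k / (32 * (real k)\<^sup>2))"

lemma len_wt_0 [simp]: "len_wt 0 = 1"
  by (simp add: len_wt_def)

lemma len_wt_pos: "0 < len_wt k"
  by (simp add: len_wt_def)

text \<open>The factor 32 gained per edge beats the growth of the square, which is at most fourfold;
  at \<open>k = 0\<close> both values are 1.\<close>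

lemma mono_len_wt: "mono len_wt"
proof (rule incseq_SucI)
  fix k
  show "len_wt k \<le> len_wt (Suc k)"
  proof (cases "k = 0")
    case False
    then have "(1 + real k)\<^sup>2 \<le> (2 * real k)\<^sup>2"
      by (intro power_mono) auto
    also have "\<dots> \<le> 32 * (real k)\<^sup>2"
      unfolding power_mult_distrib by (intro mult_right_mono) auto
    finally have "(1 + real k)\<^sup>2 \<le> 32 * (real k)\<^sup>2" .
    then have "32 ^ k * (1 + real k)\<^sup>2 \<le> 32 ^ k * (32 * (real k)\<^sup>2)"
      by (rule mult_left_mono) simp
    with False show ?thesis
      by (simp add: len_wt_def field_simps)
  qed (simp add: len_wt_def)
qed

lemma len_wt_add: "1 \<le> k \<Longrightarrow> len_wt (k + j) \<le> 32 ^ j * len_wt k"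
proof -
  assume "1 \<le> k"
  then have "32 ^ (k + j) / (32 * (real (k + j))\<^sup>2) \<le> (32 ^ (k + j) / (32 * (real k)\<^sup>2) :: real)"
    by (intro divide_left_mono mult_left_mono power_mono) auto
  with \<open>1 \<le> k\<close> show ?thesis
    by (simp add: len_wt_def power_add mult.commute)
qed

lemma sum_inverse_squares_le: "(\<Sum>k=1..<m. 1 / (real k)\<^sup>2) \<le> 2"
proof -
  \<comment> \<open>The correction \<open>1 / real n\<close> makes the induction telescope, as
    1/(n+1)^2 is at most 1/n - 1/(n+1).\<close>
  have "(\<Sum>k=1..<Suc n. 1 / (real k)\<^sup>2) \<le> 2 - 1 / real n" if "1 \<le> n" for n
    using that
  proof (induction n rule: dec_induct)
    case (step n)
    have "1 / (real (Suc n))\<^sup>2 \<le> 1 / (real n * real (Suc n))"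
      unfolding power2_eq_square using step(1) by (intro divide_left_mono mult_right_mono) auto
    also have "\<dots> = 1 / real n - 1 / real (Suc n)"
      using step(1) by (simp add: field_simps)
    finally have "1 / (real (Suc n))\<^sup>2 \<le> 1 / real n - 1 / real (Suc n)" .
    with step show ?case by simp
  qed simp
  note bound = this
  show ?thesis
  proof (cases "2 \<le> m")
    case True
    then have "(\<Sum>k=1..<m. 1 / (real k)\<^sup>2) \<le> 2 - 1 / real (m - 1)"
      using bound[of "m - 1"] by simp
    also have "\<dots> \<le> 2" by simp
    finally show ?thesis .
  qed simp
qed

text \<open>The exponentials multiply to \<open>32 ^ m\<close> and leave the factor 1/1024. Partial
  fractions bound the inverse square of \<open>k * (m - k)\<close> by the sum of the inverse squares
  of its factors times 2/m^2, and inverse squares are summable.\<close>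

lemma len_wt_convolution:
  "(\<Sum>k=1..<m. len_wt (m - k) * len_wt k) \<le> len_wt m / 4"
proof (cases "m = 0")
  case False
  define A where "A = (32 ^ m / 1024) * (2 / (real m)\<^sup>2)"
  have "len_wt (m - k) * len_wt k \<le> A * (1 / (real k)\<^sup>2 + 1 / (real (m - k))\<^sup>2)"
    if "k \<in> {1..<m}" for k
  proof -
    define x y where "x = real k" and "y = real (m - k)"
    have xy: "0 < x" "0 < y" "real m = x + y" using that by (auto simp: x_def y_def)
    have "x + y \<noteq> 0" using xy by simp
    then have "1 / (x * y) = (1 / x + 1 / y) / (x + y)"
      using xy by (simp add: add_frac_eq add.commute)
    then have "(1 / (x * y))\<^sup>2 = (1 / x + 1 / y)\<^sup>2 / (x + y)\<^sup>2"
      by (simp only: power_divide)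
    also have "\<dots> \<le> (2 * ((1 / x)\<^sup>2 + (1 / y)\<^sup>2)) / (x + y)\<^sup>2"
      using sum_squares_bound[of "1 / x" "1 / y"]
      by (intro divide_right_mono zero_le_power2) (simp add: power2_sum)
    finally have *: "1 / (x\<^sup>2 * y\<^sup>2) \<le> (2 / (x + y)\<^sup>2) * (1 / x\<^sup>2 + 1 / y\<^sup>2)"
      by (simp add: power_divide power_mult_distrib)
    have "32 ^ m = 32 ^ (m - k) * (32 ^ k :: real)"
      using that by (simp flip: power_add)
    then have "len_wt (m - k) * len_wt k = (32 ^ m / 1024) * (1 / (x\<^sup>2 * y\<^sup>2))"
      using that by (simp add: len_wt_def x_def y_def mult.commute)
    also have "\<dots> \<le> (32 ^ m / 1024) * ((2 / (x + y)\<^sup>2) * (1 / x\<^sup>2 + 1 / y\<^sup>2))"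
      using * by (rule mult_left_mono) simp
    finally show ?thesis by (simp only: A_def x_def[symmetric] y_def[symmetric] xy(3) mult.assoc)
  qed
  then have "(\<Sum>k=1..<m. len_wt (m - k) * len_wt k) \<le> (\<Sum>k=1..<m. A * (1 / (real k)\<^sup>2 + 1 / (real (m - k))\<^sup>2))"
    by (rule sum_mono)
  also have "\<dots> = A * ((\<Sum>k=1..<m. 1 / (real k)\<^sup>2) + (\<Sum>k=1..<m. 1 / (real (m - k))\<^sup>2))"
    by (simp only: sum_distrib_left[symmetric] sum.distrib)
  also have "(\<Sum>k=1..<m. 1 / (real (m - k))\<^sup>2) = (\<Sum>k=1..<m. 1 / (real k)\<^sup>2)"
    by (rule sum.reindex_bij_witness[where i = "\<lambda>k. m - k" and j = "\<lambda>k. m - k"]) auto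
  also have "A * ((\<Sum>k=1..<m. 1 / (real k)\<^sup>2) + (\<Sum>k=1..<m. 1 / (real k)\<^sup>2)) \<le> A * (2 + 2)"
    by (intro mult_left_mono add_mono sum_inverse_squares_le) (simp add: A_def)
  \<comment> \<open>Four times \<open>A\<close> is 32^m / (128 m^2).\<close>
  also have "\<dots> = len_wt m / 4"
    using False by (simp add: A_def len_wt_def)
  finally show ?thesis .
qed simp

text \<open>Here \<open>b\<close> stands for the absolute value of \<open>\<beta>\<close>. Each sum
  takes at most half of the right side, whose factor \<open>length p\<close> will be weighed against
  the total length of the sequence.\<close>

lemma loop_step_bound:
  assumes "p \<noteq> []" "0 \<le> b" "b * (64 * real d ^ 3 * 32 ^ 4) \<le> 1"
  shows "b * (\<Sum>M\<in>deformations d (cyc p). len_wt (loop_len M))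
           + (\<Sum>(M, N)\<in>splittings (cyc p). len_wt (loop_len M) * len_wt (loop_len N))
         \<le> length p * len_wt (length p)"
proof -
  let ?m = "length p"
  have m: "1 \<le> ?m" using assms(1) by (simp add: Suc_leI)
  have "(\<Sum>M\<in>deformations d (cyc p). len_wt (loop_len M))
      \<le> (\<Sum>M\<in>deformations d (cyc p). 32 ^ 4 * len_wt ?m)"
    using loop_len_deformation monoD[OF mono_len_wt] len_wt_add[OF m]
    by (intro sum_mono) (meson order_trans)
  also have "\<dots> = real (card (deformations d (cyc p))) * (32 ^ 4 * len_wt ?m)" by simp
  also have "\<dots> \<le> real (4 * (?m * (2 * d) ^ 3)) * (32 ^ 4 * len_wt ?m)"
    using finite_card_deformations[OF assms(1)] len_wt_pos[of ?m]
    by (intro mult_right_mono of_nat_mono) auto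
  \<comment> \<open>4 (2d)^3 is 32 d^3; writing it as 64 d^3 times one half lets the hypothesis on
    \<open>b\<close> leave exactly half of the budget.\<close>
  also have "\<dots> = (64 * real d ^ 3 * 32 ^ 4) * (?m * len_wt ?m / 2)"
    by (simp add: power_mult_distrib)
  finally have "b * (\<Sum>M\<in>deformations d (cyc p). len_wt (loop_len M))
      \<le> (b * (64 * real d ^ 3 * 32 ^ 4)) * (?m * len_wt ?m / 2)"
    using assms(2) by (simp only: mult.assoc mult_left_mono)
  also have "\<dots> \<le> 1 * (?m * len_wt ?m / 2)"
    using assms(3) len_wt_pos[of ?m] by (intro mult_right_mono) auto
  finally have def_le: "b * (\<Sum>M\<in>deformations d (cyc p). len_wt (loop_len M)) \<le> ?m * len_wt ?m / 2"
    by simp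
  have "(\<Sum>(M, N)\<in>splittings (cyc p). len_wt (loop_len M) * len_wt (loop_len N))
      \<le> 2 * (?m * (\<Sum>k=1..<?m. len_wt (?m - k) * len_wt k))"
    using len_wt_pos by (intro sum_splittings_le assms(1) mono_len_wt) (simp add: less_imp_le)
  also have "\<dots> \<le> 2 * (?m * (len_wt ?m / 4))"
    by (intro mult_left_mono len_wt_convolution) auto
  finally show ?thesis using def_le by simp
qed

section \<open>Multiplicative weights of loop sequences\<close>

definition seq_wt :: "loopseq \<Rightarrow> real" where
  "seq_wt s = prod_list (map (\<lambda>L. len_wt (loop_len L)) s)"

lemma seq_wt_pos: "0 < seq_wt s"
  unfolding seq_wt_def by (induction s) (auto simp: len_wt_pos)

lemma seq_wt_append [simp]: "seq_wt (s @ t) = seq_wt s * seq_wt t"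
  by (simp add: seq_wt_def)

lemma seq_wt_simps [simp]: "seq_wt [] = 1" "seq_wt (L # s) = len_wt (loop_len L) * seq_wt s"
  by (simp_all add: seq_wt_def)

text \<open>This is why \<open>len_wt 0\<close> is 1: passing to the minimal representation does not
  change the weight.\<close>

lemma seq_wt_filter_null: "seq_wt (filter (\<lambda>L. L \<noteq> null_loop) s) = seq_wt s"
  by (induction s) (auto simp: null_loop_def)

lemma seq_wt_replace_comp:
  assumes "i < length s"
  shows "seq_wt (replace_comp s i t) = seq_wt s / len_wt (loop_len (s ! i)) * seq_wt t"
proof -
  have "seq_wt s = seq_wt (take i s @ s ! i # drop (Suc i) s)"
    using id_take_nth_drop[OF assms] by (rule arg_cong)
  also have "\<dots> = seq_wt (take i s) * (len_wt (loop_len (s ! i)) * seq_wt (drop (Suc i) s))"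
    by simp
  finally have "seq_wt s = seq_wt (take i s) * (len_wt (loop_len (s ! i)) * seq_wt (drop (Suc i) s))" .
  then show ?thesis
    using len_wt_pos[of "loop_len (s ! i)"]
    by (simp add: replace_comp_def seq_wt_filter_null)
qed

text \<open>This weakening of \<open>is_loopseq\<close> is what is propagated along trajectories: it spares showing
  that deformations and splittings are lattice paths again.\<close>

definition nonnull_cycles :: "loopseq \<Rightarrow> bool" where
  "nonnull_cycles s \<longleftrightarrow> (\<forall>L\<in>set s. \<exists>p. p \<noteq> [] \<and> L = cyc p)"

lemma is_loopseq_imp_nonnull_cycles:
  assumes "is_loopseq d s"
  shows "nonnull_cycles s"
  unfolding nonnull_cycles_def
proof
  fix L assume "L \<in> set s"
  then obtain p where "L = cyc p" "L \<noteq> null_loop"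
    using assms unfolding is_loopseq_def is_loop_def by blast
  then show "\<exists>p. p \<noteq> [] \<and> L = cyc p" by (auto simp: null_loop_def)
qed

lemma nonnull_cycles_replace_comp:
  assumes "nonnull_cycles s" "set t \<subseteq> range cyc"
  shows "nonnull_cycles (replace_comp s i t)"
proof -
  have "\<exists>p. p \<noteq> [] \<and> L = cyc p" if "L \<in> set t" "L \<noteq> null_loop" for L
  proof -
    obtain p where "L = cyc p" using \<open>L \<in> set t\<close> assms(2) by blast
    with \<open>L \<noteq> null_loop\<close> show ?thesis by (auto simp: null_loop_def)
  qed
  then show ?thesis
    using assms(1) unfolding nonnull_cycles_def replace_comp_def
    by (auto dest: in_set_takeD in_set_dropD)
qed

section \<open>Moves between loop sequences\<close>

definition deformation_moves :: "nat \<Rightarrow> loopseq \<Rightarrow> loopseq set" where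
  "deformation_moves d s =
     (\<lambda>(i, M). replace_comp s i [M]) ` (SIGMA i:{..<length s}. deformations d (s ! i))"

definition splitting_moves :: "loopseq \<Rightarrow> loopseq set" where
  "splitting_moves s =
     (\<lambda>(i, y). replace_comp s i [fst y, snd y]) ` (SIGMA i:{..<length s}. splittings (s ! i))"

lemma is_def_iff: "is_pos_def d s s' \<or> is_neg_def d s s' \<longleftrightarrow> s' \<in> deformation_moves d s"
proof -
  have "s' \<in> deformation_moves d s \<longleftrightarrow> (\<exists>i<length s. \<exists>M\<in>deformations d (s ! i). s' = replace_comp s i [M])"
    by (auto simp: deformation_moves_def)
  then show ?thesis
    unfolding is_pos_def_def is_neg_def_def deformations_def by blast
qed

lemma is_split_iff: "is_pos_split s s' \<or> is_neg_split s s' \<longleftrightarrow> s' \<in> splitting_moves s"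
proof -
  have "s' \<in> splitting_moves s \<longleftrightarrow> (\<exists>i<length s. \<exists>y\<in>splittings (s ! i). s' = replace_comp s i [fst y, snd y])"
    unfolding splitting_moves_def by (auto simp: image_iff)
  then show ?thesis
    unfolding is_pos_split_def is_neg_split_def splittings_def case_prod_unfold by blast
qed

lemma is_move_iff: "is_move d s s' \<longleftrightarrow> s' \<in> deformation_moves d s \<union> splitting_moves s"
  unfolding is_move_def Un_iff is_def_iff[symmetric] is_split_iff[symmetric] by blast

text \<open>A successor may be both a deformation and a splitting, and \<open>step_weight\<close>
  takes the first match. Adding both contributions lets the two kinds be summed separately.\<close>

lemma abs_step_weight_le:
  "\<bar>step_weight d \<beta> s s'\<bar> \<le>
     (if s' \<in> deformation_moves d s then \<bar>\<beta>\<bar> / seq_len s else 0) +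
     (if s' \<in> splitting_moves s then 1 / seq_len s else 0)"
proof -
  have "\<bar>step_weight d \<beta> s s'\<bar> =
     (if s' \<in> deformation_moves d s then \<bar>\<beta>\<bar> / seq_len s
      else if s' \<in> splitting_moves s then 1 / seq_len s else 0)"
    by (simp add: step_weight_def is_def_iff[symmetric] is_split_iff[symmetric])
  then show ?thesis by simp
qed

lemma nonnull_cycles_move:
  assumes "nonnull_cycles s" "is_move d s s'"
  shows "nonnull_cycles s'"
proof -
  have cyc: "\<exists>p. s ! i = cyc p" if "i < length s" for i
    using assms(1) nth_mem[OF that] unfolding nonnull_cycles_def by blast
  from assms(2) show ?thesis
    unfolding is_move_iff deformation_moves_def splitting_moves_def
  proof (elim UnE imageE SigmaE, goal_cases)
    case (1 x i M)
    then show ?case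
      using cyc[of i] deformations_range_cyc[of M d] assms(1)
      by (auto intro!: nonnull_cycles_replace_comp)
  next
    case (2 x i y)
    then show ?case
      using splittings_range_cyc[of "fst y" "snd y" "s ! i"] assms(1)
      by (auto intro!: nonnull_cycles_replace_comp split: prod.splits)
  qed
qed

text \<open>With successors grouped by the replaced component, component \<open>i\<close> costs at
  most \<open>seq_wt s\<close> times its share of the total length, and the shares add up to
  one.\<close>

lemma seq_wt_superharmonic:
  assumes s: "nonnull_cycles s" "s \<noteq> []" and \<beta>: "\<bar>\<beta>\<bar> * (64 * real d ^ 3 * 32 ^ 4) \<le> 1"
    and "finite S"
  shows "(\<Sum>s'\<in>S. \<bar>step_weight d \<beta> s s'\<bar> * seq_wt s') \<le> seq_wt s"
proof -
  have comp: "\<exists>p. p \<noteq> [] \<and> s ! i = cyc p" if "i < length s" for i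
    using s(1) that by (auto simp: nonnull_cycles_def)
  have fin: "finite (deformations d (s ! i))" "finite (splittings (s ! i))" if "i < length s" for i
    using comp[OF that] finite_card_deformations finite_splittings by auto
  have seq_len: "real (seq_len s) = (\<Sum>i<length s. real (loop_len (s ! i)))"
    by (simp add: seq_len_def sum_list_sum_nth atLeast0LessThan)
  have "0 < loop_len (s ! 0)" using comp[of 0] s(2) by auto
  then have pos: "0 < real (seq_len s)"
    unfolding seq_len using s(2) by (intro sum_pos2[of _ 0]) auto
  \<comment> \<open>Terms outside \<open>T\<close> vanish, and what remains of \<open>S\<close> can
    be enlarged to all of \<open>T\<close>.\<close>
  have restrict: "(\<Sum>s'\<in>S. (if s' \<in> T then c else 0) * seq_wt s') \<le> c * sum seq_wt T"
    if "finite T" "0 \<le> c" for T c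
  proof -
    have "(\<Sum>s'\<in>S. (if s' \<in> T then c else 0) * seq_wt s') = (\<Sum>s'\<in>S \<inter> T. c * seq_wt s')"
      using \<open>finite S\<close> by (simp add: sum.inter_restrict if_distrib if_distribR cong: if_cong)
    also have "\<dots> \<le> (\<Sum>s'\<in>T. c * seq_wt s')"
      using that seq_wt_pos by (intro sum_mono2) (auto simp: less_imp_le)
    finally show ?thesis by (simp add: sum_distrib_left)
  qed
  let ?D = "\<lambda>i. \<Sum>M\<in>deformations d (s ! i). len_wt (loop_len M)"
  let ?P = "\<lambda>i. \<Sum>(M, N)\<in>splittings (s ! i). len_wt (loop_len M) * len_wt (loop_len N)"
  \<comment> \<open>\<open>?q i\<close> is the weight of the sequence without its component
    \<open>i\<close>.\<close>
  let ?q = "\<lambda>i. seq_wt s / len_wt (loop_len (s ! i))"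
  have D: "sum seq_wt (deformation_moves d s) \<le> (\<Sum>i<length s. ?q i * ?D i)"
  proof -
    \<comment> \<open>Different choices may give the same successor; summing over choices only
      counts positive terms more often.\<close>
    have "sum seq_wt (deformation_moves d s)
        \<le> (\<Sum>(i, M)\<in>(SIGMA i:{..<length s}. deformations d (s ! i)). seq_wt (replace_comp s i [M]))"
      unfolding deformation_moves_def using fin seq_wt_pos
      by (intro order_trans[OF sum_image_le]) (auto simp: less_imp_le o_def case_prod_unfold)
    also have "\<dots> = (\<Sum>i<length s. \<Sum>M\<in>deformations d (s ! i). seq_wt (replace_comp s i [M]))"
      using fin by (intro sum.Sigma[symmetric]) auto
    also have "\<dots> = (\<Sum>i<length s. ?q i * ?D i)"
      by (simp add: seq_wt_replace_comp sum_distrib_left)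
    finally show ?thesis .
  qed
  have P: "sum seq_wt (splitting_moves s) \<le> (\<Sum>i<length s. ?q i * ?P i)"
  proof -
    have "sum seq_wt (splitting_moves s)
        \<le> (\<Sum>(i, y)\<in>(SIGMA i:{..<length s}. splittings (s ! i)). seq_wt (replace_comp s i [fst y, snd y]))"
      unfolding splitting_moves_def using fin seq_wt_pos
      by (intro order_trans[OF sum_image_le]) (auto simp: less_imp_le o_def case_prod_unfold)
    also have "\<dots> = (\<Sum>i<length s. \<Sum>y\<in>splittings (s ! i). seq_wt (replace_comp s i [fst y, snd y]))"
      using fin by (intro sum.Sigma[symmetric]) auto
    also have "\<dots> = (\<Sum>i<length s. ?q i * ?P i)"
      by (simp add: seq_wt_replace_comp sum_distrib_left case_prod_unfold)
    finally show ?thesis .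
  qed
  have finD: "finite (deformation_moves d s)" and finP: "finite (splitting_moves s)"
    unfolding deformation_moves_def splitting_moves_def using fin by auto
  have "(\<Sum>s'\<in>S. \<bar>step_weight d \<beta> s s'\<bar> * seq_wt s')
      \<le> (\<Sum>s'\<in>S. ((if s' \<in> deformation_moves d s then \<bar>\<beta>\<bar> / seq_len s else 0) +
                (if s' \<in> splitting_moves s then 1 / seq_len s else 0)) * seq_wt s')"
    using seq_wt_pos by (intro sum_mono mult_right_mono abs_step_weight_le) (auto simp: less_imp_le)
  also have "\<dots> = (\<Sum>s'\<in>S. (if s' \<in> deformation_moves d s then \<bar>\<beta>\<bar> / seq_len s else 0) * seq_wt s')
      + (\<Sum>s'\<in>S. (if s' \<in> splitting_moves s then 1 / seq_len s else 0) * seq_wt s')"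
    by (simp only: distrib_right sum.distrib)
  also have "\<dots> \<le> \<bar>\<beta>\<bar> / seq_len s * (\<Sum>i<length s. ?q i * ?D i) + 1 / seq_len s * (\<Sum>i<length s. ?q i * ?P i)"
    using restrict[OF finD, of "\<bar>\<beta>\<bar> / seq_len s"] restrict[OF finP, of "1 / seq_len s"]
      mult_left_mono[OF D, of "\<bar>\<beta>\<bar> / seq_len s"] mult_left_mono[OF P, of "1 / seq_len s"] by simp
  also have "\<dots> = (\<Sum>i<length s. ?q i * (\<bar>\<beta>\<bar> * ?D i + ?P i)) / seq_len s"
    by (simp add: sum_distrib_left sum.distrib distrib_left add_divide_distrib mult_ac sum_divide_distrib)
  also have "\<dots> \<le> (\<Sum>i<length s. seq_wt s * loop_len (s ! i)) / seq_len s"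
  proof (intro divide_right_mono sum_mono)
    fix i assume "i \<in> {..<length s}"
    then obtain p where p: "p \<noteq> []" "s ! i = cyc p" using comp by auto
    have "?q i * (\<bar>\<beta>\<bar> * ?D i + ?P i) \<le> ?q i * (loop_len (s ! i) * len_wt (loop_len (s ! i)))"
      using loop_step_bound[OF p(1) abs_ge_zero \<beta>] p(2) seq_wt_pos[of s] len_wt_pos
      by (intro mult_left_mono) (auto simp: less_imp_le)
    also have "\<dots> = seq_wt s * loop_len (s ! i)"
      using len_wt_pos[of "loop_len (s ! i)"] by simp
    finally show "?q i * (\<bar>\<beta>\<bar> * ?D i + ?P i) \<le> seq_wt s * loop_len (s ! i)" .
  qed simp
  also have "\<dots> = seq_wt s"
    using pos by (simp add: sum_distrib_left[symmetric] seq_len[symmetric])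
  finally show ?thesis .
qed

section \<open>Summation over vanishing trajectories\<close>

lemma vanishing_trajectories_Nil: "vanishing_trajectories d [] = {[[]]}"
proof -
  have "X = [[]]" if "X \<in> vanishing_trajectories d []" for X
  proof (cases X)
    case (Cons t X')
    \<comment> \<open>A move replaces a component and \<open>[]\<close> has none, so there is no
      second state.\<close>
    then have "X' \<noteq> [] \<Longrightarrow> is_move d [] (hd X')" "t = []"
      using that by (force simp: vanishing_trajectories_def hd_conv_nth)+
    with Cons show ?thesis
      by (auto simp: is_move_iff deformation_moves_def splitting_moves_def)
  qed (use that in \<open>auto simp: vanishing_trajectories_def\<close>)
  moreover have "[[]] \<in> vanishing_trajectories d []"
    by (simp add: vanishing_trajectories_def)
  ultimately show ?thesis by blast
qed

text \<open>A trajectory from a nonempty \<open>s\<close> must still reach \<open>[]\<close>, so it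
  has a second state \<open>hd (tl X)\<close>; cutting off the first state gives the recursion for
  the sums.\<close>

lemma vanishing_trajectories_nonempty_decomp:
  assumes "X \<in> vanishing_trajectories d s" "s \<noteq> []"
  shows "tl X \<in> vanishing_trajectories d (hd (tl X))" "is_move d s (hd (tl X))" "X = s # tl X"
    "traj_weight d \<beta> X = step_weight d \<beta> s (hd (tl X)) * traj_weight d \<beta> (tl X)"
proof -
  obtain t Y where X: "X = s # t # Y"
    using assms by (cases X rule: remdups_adj.cases) (auto simp: vanishing_trajectories_def)
  have moves: "is_move d (X ! i) (X ! Suc i)" if "Suc i < length X" for i
    using assms(1) that by (auto simp: vanishing_trajectories_def)
  show "tl X \<in> vanishing_trajectories d (hd (tl X))"
    using assms(1) moves[of "Suc _"] X by (auto simp: vanishing_trajectories_def split: if_splits)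
  show "is_move d s (hd (tl X))" using moves[of 0] X by simp
  show "X = s # tl X" using X by simp
  show "traj_weight d \<beta> X = step_weight d \<beta> s (hd (tl X)) * traj_weight d \<beta> (tl X)"
    using X by (simp add: traj_weight_def prod.lessThan_Suc_shift del: prod.lessThan_Suc)
qed

text \<open>Grouped by their second state, the trajectories have shorter tails, which the induction
  bounds, and \<open>seq_wt_superharmonic\<close> sums the first steps. The bound is free of
  \<open>n\<close>, hence uniform over all finite \<open>Y\<close>.\<close>

lemma sum_traj_weight_le:
  assumes \<beta>: "\<bar>\<beta>\<bar> * (64 * real d ^ 3 * 32 ^ 4) \<le> 1"
    and "nonnull_cycles s" "finite Y" "Y \<subseteq> vanishing_trajectories d s" "\<And>X. X \<in> Y \<Longrightarrow> length X \<le> n"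
  shows "(\<Sum>X\<in>Y. \<bar>traj_weight d \<beta> X\<bar>) \<le> seq_wt s"
  using assms(2-)
proof (induction n arbitrary: s Y)
  case 0
  \<comment> \<open>Trajectories are nonempty lists.\<close>
  then have "Y = {}" by (force simp: vanishing_trajectories_def)
  then show ?case using seq_wt_pos[of s] by simp
next
  case (Suc n)
  show ?case
  proof (cases "s = []")
    case True
    \<comment> \<open>Only the trajectory with the single state \<open>[]\<close> is possible; its
      empty product is 1, the weight of \<open>[]\<close>.\<close>
    then have "(\<Sum>X\<in>Y. \<bar>traj_weight d \<beta> X\<bar>) \<le> (\<Sum>X\<in>{[[]]}. \<bar>traj_weight d \<beta> X\<bar>)"
      using Suc.prems vanishing_trajectories_Nil by (intro sum_mono2) auto
    then show ?thesis using True by (simp add: traj_weight_def)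
  next
    case False
    let ?g = "\<lambda>X :: loopseq list. hd (tl X)"
    let ?Y = "\<lambda>s'. {X \<in> Y. ?g X = s'}"
    note decomp = vanishing_trajectories_nonempty_decomp[OF subsetD[OF Suc.prems(3)] False]
    have "(\<Sum>X\<in>Y. \<bar>traj_weight d \<beta> X\<bar>) = (\<Sum>s'\<in>?g ` Y. \<Sum>X\<in>?Y s'. \<bar>traj_weight d \<beta> X\<bar>)"
      using Suc.prems(2) by (rule sum.image_gen)
    also have "\<dots> \<le> (\<Sum>s'\<in>?g ` Y. \<bar>step_weight d \<beta> s s'\<bar> * seq_wt s')"
    proof (rule sum_mono)
      fix s' assume s': "s' \<in> ?g ` Y"
      \<comment> \<open>All these trajectories start at \<open>s\<close>, so their tails determine
        them.\<close>
      have inj: "inj_on tl (?Y s')"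
        using decomp(3) by (intro inj_onI) (metis (no_types, lifting) mem_Collect_eq)
      have "(\<Sum>X\<in>?Y s'. \<bar>traj_weight d \<beta> X\<bar>)
          = \<bar>step_weight d \<beta> s s'\<bar> * (\<Sum>X\<in>?Y s'. \<bar>traj_weight d \<beta> (tl X)\<bar>)"
        unfolding sum_distrib_left by (rule sum.cong) (auto simp: decomp(4) abs_mult)
      also have "(\<Sum>X\<in>?Y s'. \<bar>traj_weight d \<beta> (tl X)\<bar>) = (\<Sum>X\<in>tl ` ?Y s'. \<bar>traj_weight d \<beta> X\<bar>)"
        using inj by (simp add: sum.reindex)
      also have "\<dots> \<le> seq_wt s'"
      proof (rule Suc.IH)
        show "nonnull_cycles s'"
          using s' decomp(2) nonnull_cycles_move[OF Suc.prems(1)] by blast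
        show "tl ` ?Y s' \<subseteq> vanishing_trajectories d s'" using decomp(1) by blast
        show "length X \<le> n" if "X \<in> tl ` ?Y s'" for X
          using that Suc.prems(4) by fastforce
      qed (use Suc.prems(2) in simp)
      finally show "(\<Sum>X\<in>?Y s'. \<bar>traj_weight d \<beta> X\<bar>) \<le> \<bar>step_weight d \<beta> s s'\<bar> * seq_wt s'"
        by (simp add: mult_left_mono)
    qed
    also have "\<dots> \<le> seq_wt s"
      using Suc.prems(1,2) False \<beta> by (intro seq_wt_superharmonic) auto
    finally show ?thesis .
  qed
qed

theorem theorem11p1:
  fixes d :: nat
  assumes "2 \<le> d"
  shows "\<exists>\<beta>2>0. \<forall>\<beta>::real. \<bar>\<beta>\<bar> \<le> \<beta>2 \<longrightarrow>
           (\<forall>s. is_loopseq d s \<and> s \<noteq> [] \<longrightarrow>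
              (\<lambda>X. \<bar>traj_weight d \<beta> X\<bar>) summable_on vanishing_trajectories d s)"
proof (intro exI conjI allI impI)
  let ?c = "64 * real d ^ 3 * 32 ^ 4"
  \<comment> \<open>This threshold is the largest \<open>\<beta>2\<close> satisfying the smallness
    hypothesis of \<open>loop_step_bound\<close>.\<close>
  show "0 < 1 / ?c" using assms by simp
  fix \<beta> :: real and s
  assume "\<bar>\<beta>\<bar> \<le> 1 / ?c" and s: "is_loopseq d s \<and> s \<noteq> []"
  then have \<beta>: "\<bar>\<beta>\<bar> * ?c \<le> 1" using assms by (simp add: field_simps)
  have "(\<Sum>X\<in>Y. \<bar>traj_weight d \<beta> X\<bar>) \<le> seq_wt s"
    if "finite Y" "Y \<subseteq> vanishing_trajectories d s" for Y
    using that is_loopseq_imp_nonnull_cycles[of d s] s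
    \<comment> \<open>A longest member of the finite set \<open>Y\<close> supplies \<open>n\<close>;
      for empty \<open>Y\<close> the length condition is vacuous.\<close>
    by (intro sum_traj_weight_le[OF \<beta>, where n = "Max (length ` Y)"]) auto
  then show "(\<lambda>X. \<bar>traj_weight d \<beta> X\<bar>) summable_on vanishing_trajectories d s"
    \<comment> \<open>For nonnegative terms, a common bound on all finite partial sums gives
      summability.\<close>
    by (intro nonneg_bdd_above_summable_on bdd_aboveI2[where M = "seq_wt s"]) auto
qed

end
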